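(* Let $\mathcal{F}$ be any one of the following varieties: distributive lattices, Boolean algebras, rings, semigroups, monoids, groups. Then every $\mathcal{F}$-subshift $X$ is cellwise up to algebraic conjugacy: there exist a cellwise $\mathcal{F}$-subshift $Y$ and an algebraic conjugacy $\phi: X \to Y$.
   Context: The listed classes are the usual varieties of algebras; Boolean algebras have operations $\wedge,\vee$, complement, $1$, $0$. A homomorphism between algebras in $\mathcal{F}$ is called an $\mathcal{F}$-morphism. The shift map on $S^{\mathbb{Z}}$ is $\sigma(x)_i=x_{i+1}$; a subshift is a closed $\sigma$-invariant subset of $S^{\mathbb{Z}}$ for a finite alphabet $S$; a block map is a continuous shift-commuting map between subshifts (for maps $X^n\to X$, $X^n$ carries the product topology and the diagonal shift); a conjugacy is a bijective block map. An $\mathcal{F}$-subshift is a subshift $X\subset S^{\mathbb{Z}}$ ($S$ a finite set) equipped with an algebra structure in $\mathcal{F}$ all of whose operations $X^n \to X$ are block maps. If $R \in \mathcal{F}$ is finite, $R^{\mathbb{Z}}$ carries the cellwise structure $f(x^1,\dots,x^n)_i = f(x^1_i,\dots,x^n_i)$; a subshift $Y \subset R^{\mathbb{Z}}$ that is a subalgebra of $R^{\mathbb{Z}}$ is called a cellwise $\mathcal{F}$-subshift. A conjugacy that is also an $\mathcal{F}$-morphism is called algebraic. *)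

theory Defs
  imports "HOL-Analysis.Function_Topology"
begin

section \<open>Varieties of algebras\<close>

datatype 'f trm = Var nat | App 'f "'f trm list"

record 'f variety =
  symbols :: "'f set"
  arity :: "'f \<Rightarrow> nat"
  identities :: "('f trm \<times> 'f trm) set"

text \<open>An algebra is a carrier \<open>A\<close> with an interpretation \<open>I\<close> of the operation symbols.
  An \<open>n\<close>-tuple of arguments is a list of length \<open>n\<close>; the behaviour of \<open>I\<close> on symbols not in
  the signature, on lists of the wrong length, and outside \<open>A\<close> is irrelevant.\<close>

type_synonym ('f, 'a) interp = "'f \<Rightarrow> 'a list \<Rightarrow> 'a"

primrec eval :: "('f, 'a) interp \<Rightarrow> (nat \<Rightarrow> 'a) \<Rightarrow> 'f trm \<Rightarrow> 'a" where
  "eval I v (Var n) = v n"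
| "eval I v (App f ts) = I f (map (eval I v) ts)"

definition tuples :: "nat \<Rightarrow> 'a set \<Rightarrow> 'a list set" where
  "tuples n A = {xs. length xs = n \<and> set xs \<subseteq> A}"

definition closed_under :: "'f variety \<Rightarrow> 'a set \<Rightarrow> ('f, 'a) interp \<Rightarrow> bool" where
  "closed_under F A I \<longleftrightarrow> (\<forall>f\<in>symbols F. \<forall>xs\<in>tuples (arity F f) A. I f xs \<in> A)"

text \<open>The empty carrier is not excluded (it occurs only for signatures without constants).\<close>

definition in_variety :: "'f variety \<Rightarrow> 'a set \<Rightarrow> ('f, 'a) interp \<Rightarrow> bool" where
  "in_variety F A I \<longleftrightarrow>
     closed_under F A I \<and>
     (\<forall>(s, t)\<in>identities F. \<forall>v. range v \<subseteq> A \<longrightarrow> eval I v s = eval I v t)"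

definition subalgebra_of :: "'f variety \<Rightarrow> 'a set \<Rightarrow> 'a set \<Rightarrow> ('f, 'a) interp \<Rightarrow> bool" where
  "subalgebra_of F B A I \<longleftrightarrow> B \<subseteq> A \<and> closed_under F B I"

definition morphism ::
  "'f variety \<Rightarrow> 'a set \<Rightarrow> ('f, 'a) interp \<Rightarrow> 'b set \<Rightarrow> ('f, 'b) interp \<Rightarrow> ('a \<Rightarrow> 'b) \<Rightarrow> bool" where
  "morphism F A I B J \<phi> \<longleftrightarrow>
     \<phi> ` A \<subseteq> B \<and>
     (\<forall>f\<in>symbols F. \<forall>xs\<in>tuples (arity F f) A. \<phi> (I f xs) = J f (map \<phi> xs))"


section \<open>The concrete varieties\<close>

datatype opsym = Meet | Join | Compl | Top | Bot | Plus | Minus | Zero | Times | Inv | One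

fun op_arity :: "opsym \<Rightarrow> nat" where
  "op_arity Meet = 2"
| "op_arity Join = 2"
| "op_arity Compl = 1"
| "op_arity Top = 0"
| "op_arity Bot = 0"
| "op_arity Plus = 2"
| "op_arity Minus = 1"
| "op_arity Zero = 0"
| "op_arity Times = 2"
| "op_arity Inv = 1"
| "op_arity One = 0"

abbreviation "vx \<equiv> Var 0 :: opsym trm"
abbreviation "vy \<equiv> Var 1 :: opsym trm"
abbreviation "vz \<equiv> Var 2 :: opsym trm"

abbreviation "tmeet s t \<equiv> App Meet [s, t]"
abbreviation "tjoin s t \<equiv> App Join [s, t]"
abbreviation "tcompl s \<equiv> App Compl [s]"
abbreviation "ttop \<equiv> App Top []"
abbreviation "tbot \<equiv> App Bot []"
abbreviation "tplus s t \<equiv> App Plus [s, t]"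
abbreviation "tminus s \<equiv> App Minus [s]"
abbreviation "tzero \<equiv> App Zero []"
abbreviation "ttimes s t \<equiv> App Times [s, t]"
abbreviation "tinv s \<equiv> App Inv [s]"
abbreviation "tone \<equiv> App One []"

definition distributive_lattices :: "opsym variety" where
  "distributive_lattices =
     \<lparr>symbols = {Meet, Join}, arity = op_arity,
      identities =
       {(tmeet vx vy, tmeet vy vx),
        (tjoin vx vy, tjoin vy vx),
        (tmeet (tmeet vx vy) vz, tmeet vx (tmeet vy vz)),
        (tjoin (tjoin vx vy) vz, tjoin vx (tjoin vy vz)),
        (tmeet vx vx, vx),
        (tjoin vx vx, vx),
        (tmeet vx (tjoin vx vy), vx),
        (tjoin vx (tmeet vx vy), vx),
        (tmeet vx (tjoin vy vz), tjoin (tmeet vx vy) (tmeet vx vz)),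
        (tjoin vx (tmeet vy vz), tmeet (tjoin vx vy) (tjoin vx vz))}\<rparr>"

definition boolean_algebras :: "opsym variety" where
  "boolean_algebras =
     \<lparr>symbols = {Meet, Join, Compl, Top, Bot}, arity = op_arity,
      identities = identities distributive_lattices \<union>
       {(tmeet vx ttop, vx),
        (tjoin vx tbot, vx),
        (tmeet vx (tcompl vx), tbot),
        (tjoin vx (tcompl vx), ttop)}\<rparr>"

definition semigroups :: "opsym variety" where
  "semigroups =
     \<lparr>symbols = {Times}, arity = op_arity,
      identities = {(ttimes (ttimes vx vy) vz, ttimes vx (ttimes vy vz))}\<rparr>"

definition monoids :: "opsym variety" where
  "monoids =
     \<lparr>symbols = {Times, One}, arity = op_arity,
      identities = identities semigroups \<union>
       {(ttimes tone vx, vx),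
        (ttimes vx tone, vx)}\<rparr>"

definition groups :: "opsym variety" where
  "groups =
     \<lparr>symbols = {Times, Inv, One}, arity = op_arity,
      identities = identities monoids \<union>
       {(ttimes (tinv vx) vx, tone),
        (ttimes vx (tinv vx), tone)}\<rparr>"

text \<open>Rings need not be commutative. Both conventions about the multiplicative identity are
  provided: \<open>rings\<close> does not have it in the signature, \<open>unital_rings\<close> does.\<close>

definition rings :: "opsym variety" where
  "rings =
     \<lparr>symbols = {Plus, Minus, Zero, Times}, arity = op_arity,
      identities = identities semigroups \<union>
       {(tplus (tplus vx vy) vz, tplus vx (tplus vy vz)),
        (tplus vx vy, tplus vy vx),
        (tplus vx tzero, vx),
        (tplus vx (tminus vx), tzero),
        (ttimes vx (tplus vy vz), tplus (ttimes vx vy) (ttimes vx vz)),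
        (ttimes (tplus vx vy) vz, tplus (ttimes vx vz) (ttimes vy vz))}\<rparr>"

definition unital_rings :: "opsym variety" where
  "unital_rings =
     \<lparr>symbols = {Plus, Minus, Zero, Times, One}, arity = op_arity,
      identities = identities rings \<union> identities monoids\<rparr>"


section \<open>Subshifts and block maps\<close>

definition shift :: "(int \<Rightarrow> 's) \<Rightarrow> int \<Rightarrow> 's" where
  "shift x = (\<lambda>i. x (i + 1))"

definition full_shift :: "'s set \<Rightarrow> (int \<Rightarrow> 's) topology" where
  "full_shift S = product_topology (\<lambda>_. discrete_topology S) UNIV"

text \<open>Over \<open>\<int>\<close>, invariance means \<open>\<sigma>(X) = X\<close>. The empty subshift is allowed.\<close>

definition subshift :: "'s set \<Rightarrow> (int \<Rightarrow> 's) set \<Rightarrow> bool" where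
  "subshift S X \<longleftrightarrow> finite S \<and> closedin (full_shift S) X \<and> shift ` X = X"

definition block_map ::
  "'s set \<Rightarrow> (int \<Rightarrow> 's) set \<Rightarrow> 't set \<Rightarrow> (int \<Rightarrow> 't) set \<Rightarrow> ((int \<Rightarrow> 's) \<Rightarrow> (int \<Rightarrow> 't)) \<Rightarrow> bool" where
  "block_map S X T Y \<phi> \<longleftrightarrow>
     continuous_map (subtopology (full_shift S) X) (subtopology (full_shift T) Y) \<phi> \<and>
     (\<forall>x\<in>X. \<phi> (shift x) = shift (\<phi> x))"

text \<open>Block maps \<open>X\<^sup>n \<rightarrow> X\<close>: the tuple \<open>(x 0, \<dots>, x (n - 1))\<close> of the product space is passed to
  \<open>g\<close> as a list. For \<open>n = 0\<close> this says that the constant is a shift-invariant point of \<open>X\<close>.\<close>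

definition block_operation ::
  "'s set \<Rightarrow> (int \<Rightarrow> 's) set \<Rightarrow> nat \<Rightarrow> ((int \<Rightarrow> 's) list \<Rightarrow> (int \<Rightarrow> 's)) \<Rightarrow> bool" where
  "block_operation S X n g \<longleftrightarrow>
     continuous_map (product_topology (\<lambda>_. subtopology (full_shift S) X) {..<n})
       (subtopology (full_shift S) X) (\<lambda>x. g (map x [0..<n])) \<and>
     (\<forall>xs\<in>tuples n X. g (map shift xs) = shift (g xs))"

definition conjugacy ::
  "'s set \<Rightarrow> (int \<Rightarrow> 's) set \<Rightarrow> 't set \<Rightarrow> (int \<Rightarrow> 't) set \<Rightarrow> ((int \<Rightarrow> 's) \<Rightarrow> (int \<Rightarrow> 't)) \<Rightarrow> bool" where
  "conjugacy S X T Y \<phi> \<longleftrightarrow> block_map S X T Y \<phi> \<and> bij_betw \<phi> X Y"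


section \<open>Subshifts with algebraic structure\<close>

definition variety_subshift ::
  "'f variety \<Rightarrow> 's set \<Rightarrow> (int \<Rightarrow> 's) set \<Rightarrow> ('f, int \<Rightarrow> 's) interp \<Rightarrow> bool" where
  "variety_subshift F S X I \<longleftrightarrow>
     subshift S X \<and> in_variety F X I \<and>
     (\<forall>f\<in>symbols F. block_operation S X (arity F f) (I f))"

definition cellwise :: "('f, 'r) interp \<Rightarrow> ('f, int \<Rightarrow> 'r) interp" where
  "cellwise J f xs = (\<lambda>i. J f (map (\<lambda>x. x i) xs))"

definition cellwise_subshift ::
  "'f variety \<Rightarrow> 'r set \<Rightarrow> ('f, 'r) interp \<Rightarrow> (int \<Rightarrow> 'r) set \<Rightarrow> bool" where
  "cellwise_subshift F R J Y \<longleftrightarrow>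
     finite R \<and> in_variety F R J \<and> subshift R Y \<and>
     subalgebra_of F Y (topspace (full_shift R)) (cellwise J)"

definition algebraic_conjugacy ::
  "'f variety \<Rightarrow> 's set \<Rightarrow> (int \<Rightarrow> 's) set \<Rightarrow> ('f, int \<Rightarrow> 's) interp \<Rightarrow>
   't set \<Rightarrow> (int \<Rightarrow> 't) set \<Rightarrow> ('f, int \<Rightarrow> 't) interp \<Rightarrow> ((int \<Rightarrow> 's) \<Rightarrow> (int \<Rightarrow> 't)) \<Rightarrow> bool" where
  "algebraic_conjugacy F S X I T Y J \<phi> \<longleftrightarrow> conjugacy S X T Y \<phi> \<and> morphism F X I Y J \<phi>"

end

theory Submission
  imports Defs "HOL-Analysis.Abstract_Topological_Spaces"
begin

text \<open>The theorem rests on the fact that a compact, totally disconnected algebra in one of these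
  varieties is profinite. Suppose there is a congruence \<open>E\<close> on \<open>X\<close>,
  open in \<open>X \<times> X\<close>, such that \<open>(x, y) \<in> E\<close> forces \<open>x 0 = y 0\<close>. By compactness \<open>R = X / E\<close> is a
  finite algebra of the variety, and \<open>x \<mapsto> (i \<mapsto> [\<sigma>\<^sup>i x])\<close> is a block map into \<open>R\<^sup>\<int>\<close>. It is a
  homomorphism for the cellwise operations because \<open>\<sigma>\<close> commutes with the operations of \<open>X\<close>, and it
  is injective because the class of \<open>\<sigma>\<^sup>i x\<close> determines \<open>x i\<close>. Its image is the required cellwise
  subshift (\<open>cellwise_of_open_congruence\<close>).

  It remains to refine the open equivalence relation \<open>x 0 = y 0\<close> to an open congruence. As for
  syntactic congruences of languages, one relates \<open>x\<close> and \<open>y\<close> when their images under every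
  translation of the algebra are related. A single condition ``for all \<open>a\<close>, \<open>h a x\<close> and \<open>h a y\<close>
  are related'' preserves openness, because projections along the compact space \<open>X\<close> are closed
  maps (\<open>open_equivalence_left_core\<close>). Hence it is enough that boundedly many such conditions
  exhaust all translations. This is where the varieties enter. For an associative operation
  every translation is \<open>x\<close>, \<open>a x\<close>, \<open>x b\<close> or \<open>a x b\<close> (\<open>compatible_translation_core\<close>). For an
  operation \<open>h\<close> that distributes over \<open>g\<close>, treating first \<open>g\<close> and then \<open>h\<close> suffices, since the
  step for \<open>h\<close> does not destroy compatibility with \<open>g\<close>
  (\<open>compatible_translation_core_of_distributes\<close>); this handles rings and distributive lattices.
  Inverses, negatives and complements are determined by the binary operations in such a way that
  they respect every congruence for those operations.\<close>

section \<open>Open equivalence relations on a compact space\<close>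

definition open_equivalence :: "'a topology \<Rightarrow> ('a \<times> 'a) set \<Rightarrow> bool" where
  "open_equivalence T E \<longleftrightarrow> equiv (topspace T) E \<and> openin (prod_topology T T) E"

text \<open>The pullback of \<open>E\<close> along all left translations \<open>h a\<close>. Right translations are covered by
  exchanging the two arguments of \<open>h\<close>.\<close>

definition left_core :: "'a set \<Rightarrow> ('a \<Rightarrow> 'a \<Rightarrow> 'a) \<Rightarrow> ('a \<times> 'a) set \<Rightarrow> ('a \<times> 'a) set" where
  "left_core A h E = {(x, y) \<in> A \<times> A. \<forall>a\<in>A. (h a x, h a y) \<in> E}"

definition closed_op :: "'a set \<Rightarrow> ('a \<Rightarrow> 'a \<Rightarrow> 'a) \<Rightarrow> bool" where
  "closed_op A h \<longleftrightarrow> (\<forall>x\<in>A. \<forall>y\<in>A. h x y \<in> A)"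

lemma equiv_left_core:
  assumes "equiv A E" "closed_op A h"
  shows "equiv A (left_core A h E)"
proof (rule equivI)
  show "left_core A h E \<subseteq> A \<times> A"
    by (auto simp: left_core_def)
  show "refl_on A (left_core A h E)"
    using assms by (simp add: left_core_def refl_on_def equiv_def closed_op_def)
  show "sym (left_core A h E)"
  proof (rule symI)
    fix x y
    assume xy: "(x, y) \<in> left_core A h E"
    have "(h a y, h a x) \<in> E" if "a \<in> A" for a
    proof (rule symD)
      show "sym E"
        using assms(1) by (simp add: equiv_def)
      show "(h a x, h a y) \<in> E"
        using xy that by (simp add: left_core_def)
    qed
    with xy show "(y, x) \<in> left_core A h E"
      by (simp add: left_core_def)
  qed
  show "trans (left_core A h E)"
  proof (rule transI)
    fix x y z
    assume xyz: "(x, y) \<in> left_core A h E" "(y, z) \<in> left_core A h E"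
    then have "(h a x, h a z) \<in> E" if "a \<in> A" for a
      using that assms(1) unfolding left_core_def equiv_def by (blast dest: transD)
    with xyz show "(x, z) \<in> left_core A h E"
      by (simp add: left_core_def)
  qed
qed

lemma continuous_imp_closed_op:
  assumes "continuous_map (prod_topology T T) T (\<lambda>(a, x). h a x)"
  shows "closed_op (topspace T) h"
  using continuous_map_funspace[OF assms] by (force simp: closed_op_def)

text \<open>The complement of \<open>left_core\<close> is the projection of the closed set of triples \<open>(a, x, y)\<close>
  with \<open>(h a x, h a y) \<notin> E\<close>, and the projection forgetting \<open>a\<close> is a closed map as \<open>a\<close> ranges over
  a compact space.\<close>

lemma open_equivalence_left_core:
  fixes T :: "'a topology"
  assumes T: "compact_space T"
    and h: "continuous_map (prod_topology T T) T (\<lambda>(a, x). h a x)"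
    and E: "open_equivalence T E"
  shows "open_equivalence T (left_core (topspace T) h E)"
proof -
  let ?A = "topspace T" and ?P = "prod_topology T T"
  have "equiv ?A (left_core ?A h E)"
    using E continuous_imp_closed_op[OF h] by (simp add: equiv_left_core open_equivalence_def)
  moreover have "openin ?P (left_core ?A h E)"
  proof -
    define k where "k = (\<lambda>p. (h (fst p) (fst (snd p)), h (fst p) (snd (snd p))))"
    have one: "continuous_map (prod_topology T ?P) T (\<lambda>p. h (fst p) (s (snd p)))"
      if "continuous_map ?P T s" for s
    proof -
      have "continuous_map (prod_topology T ?P) ?P (\<lambda>p. (fst p, s (snd p)))"
        using that continuous_map_compose[OF continuous_map_snd that]
        by (auto simp: continuous_map_pairwise o_def continuous_map_fst)
      from continuous_map_compose[OF this h] show ?thesis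
        by (simp add: o_def)
    qed
    have k: "continuous_map (prod_topology T ?P) ?P k"
      unfolding k_def continuous_map_pairwise o_def
      using one[OF continuous_map_fst] one[OF continuous_map_snd] by simp
    \<comment> \<open>The counterexamples \<open>(a, x, y)\<close> to membership of \<open>(x, y)\<close>.\<close>
    define C where "C = {p \<in> topspace (prod_topology T ?P). k p \<in> topspace ?P - E}"
    have "closedin (prod_topology T ?P) C"
      unfolding C_def using k E
      by (intro closedin_continuous_map_preimage[OF k] closedin_diff closedin_topspace)
        (simp add: open_equivalence_def)
    then have "closedin ?P (snd ` C)"
      using closed_map_snd[OF T, of ?P] by (simp add: closed_map_def)
    then have "openin ?P (topspace ?P - snd ` C)"
      by (rule openin_diff[OF openin_topspace])
    moreover have "left_core ?A h E = topspace ?P - snd ` C"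
    proof -
      have closed: "h a x \<in> ?A" if "a \<in> ?A" "x \<in> ?A" for a x
        using continuous_imp_closed_op[OF h] that by (simp add: closed_op_def)
      have C_iff: "(a, (x, y)) \<in> C \<longleftrightarrow> a \<in> ?A \<and> x \<in> ?A \<and> y \<in> ?A \<and> (h a x, h a y) \<notin> E" for a x y
        using closed[of a x] closed[of a y] unfolding C_def k_def by auto
      have snd_iff: "p \<in> snd ` C \<longleftrightarrow> (\<exists>a. (a, p) \<in> C)" for p
        unfolding image_iff by (metis prod.collapse snd_conv)
      show ?thesis
      proof (rule set_eqI)
        fix p :: "'a \<times> 'a"
        obtain x y where p: "p = (x, y)"
          by (cases p)
        show "p \<in> left_core ?A h E \<longleftrightarrow> p \<in> topspace ?P - snd ` C"
          unfolding p Diff_iff snd_iff C_iff by (simp add: left_core_def) blast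
      qed
    qed
    ultimately show ?thesis
      by simp
  qed
  ultimately show ?thesis
    by (simp add: open_equivalence_def)
qed

lemma open_equivalence_Int:
  assumes "open_equivalence T E" "open_equivalence T E'"
  shows "open_equivalence T (E \<inter> E')"
  using assms unfolding open_equivalence_def equiv_def refl_on_def
  by (intro conjI openin_Int sym_Int trans_Int) blast+

lemma open_equivalence_class:
  assumes "open_equivalence T E" "x \<in> topspace T"
  shows "openin T (E `` {x})"
proof -
  have "continuous_map T (prod_topology T T) (\<lambda>y. (x, y))"
    using assms(2) by (simp add: continuous_map_pairwise o_def)
  then have "openin T {y \<in> topspace T. (x, y) \<in> E}"
    using assms(1) by (auto simp: open_equivalence_def intro: openin_continuous_map_preimage)
  moreover have "{y \<in> topspace T. (x, y) \<in> E} = E `` {x}"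
    using assms(1) by (auto simp: open_equivalence_def equiv_def)
  ultimately show ?thesis
    by simp
qed

lemma finite_quotient_open_equivalence:
  assumes "compact_space T" "open_equivalence T E"
  shows "finite (topspace T // E)"
proof -
  let ?A = "topspace T"
  have E: "equiv ?A E"
    using assms(2) by (simp add: open_equivalence_def)
  have "\<forall>U\<in>?A // E. openin T U"
    using open_equivalence_class[OF assms(2)] by (auto elim!: quotientE)
  moreover have "\<Union>(?A // E) = ?A"
    using E by (rule Union_quotient)
  ultimately obtain \<F> where \<F>: "finite \<F>" "\<F> \<subseteq> ?A // E" "\<Union>\<F> = ?A"
    using assms(1) unfolding compact_space by metis
  have "?A // E \<subseteq> \<F>"
  proof
    fix U
    assume U: "U \<in> ?A // E"
    then obtain x where x: "x \<in> U" "x \<in> ?A"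
      using E by (metis in_quotient_imp_non_empty in_quotient_imp_subset subset_empty subsetD ex_in_conv)
    then obtain V where "V \<in> \<F>" "x \<in> V"
      using \<F> by blast
    with U x \<F> E show "U \<in> \<F>"
      using quotient_disj[OF E U, of V] by blast
  qed
  with \<F> show ?thesis
    by (rule_tac finite_subset)
qed

section \<open>Compatible relations for one or two binary operations\<close>

definition compatible :: "'a set \<Rightarrow> ('a \<Rightarrow> 'a \<Rightarrow> 'a) \<Rightarrow> ('a \<times> 'a) set \<Rightarrow> bool" where
  "compatible A h E \<longleftrightarrow>
     (\<forall>x y. (x, y) \<in> E \<longrightarrow> (\<forall>a\<in>A. (h a x, h a y) \<in> E \<and> (h x a, h y a) \<in> E))"

text \<open>The four parts deal with the translations \<open>x\<close>, \<open>a x\<close>, \<open>x b\<close> and \<open>a x b\<close>. The first three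
  are not instances of the last, since there need not be a unit.\<close>

definition translation_core :: "'a set \<Rightarrow> ('a \<Rightarrow> 'a \<Rightarrow> 'a) \<Rightarrow> ('a \<times> 'a) set \<Rightarrow> ('a \<times> 'a) set" where
  "translation_core A h E =
     E \<inter> left_core A h E \<inter> left_core A (\<lambda>x y. h y x) E \<inter> left_core A h (left_core A (\<lambda>x y. h y x) E)"

definition associative_on :: "'a set \<Rightarrow> ('a \<Rightarrow> 'a \<Rightarrow> 'a) \<Rightarrow> bool" where
  "associative_on A h \<longleftrightarrow> (\<forall>x\<in>A. \<forall>y\<in>A. \<forall>z\<in>A. h (h x y) z = h x (h y z))"

definition distributes_on :: "'a set \<Rightarrow> ('a \<Rightarrow> 'a \<Rightarrow> 'a) \<Rightarrow> ('a \<Rightarrow> 'a \<Rightarrow> 'a) \<Rightarrow> bool" where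
  "distributes_on A h g \<longleftrightarrow>
     (\<forall>x\<in>A. \<forall>y\<in>A. \<forall>z\<in>A. h x (g y z) = g (h x y) (h x z) \<and> h (g x y) z = g (h x z) (h y z))"

lemma translation_core_subset: "translation_core A h E \<subseteq> E"
  by (auto simp: translation_core_def)

lemma open_equivalence_translation_core:
  assumes T: "compact_space T"
    and h: "continuous_map (prod_topology T T) T (\<lambda>(a, x). h a x)"
    and E: "open_equivalence T E"
  shows "open_equivalence T (translation_core (topspace T) h E)"
proof -
  have "continuous_map (prod_topology T T) (prod_topology T T) (\<lambda>(a, x). (x, a))"
    by (simp add: case_prod_unfold continuous_map_pairwise o_def continuous_map_fst continuous_map_snd)
  from continuous_map_compose[OF this h]
  have "continuous_map (prod_topology T T) T (\<lambda>(a, x). h x a)"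
    by (simp add: o_def case_prod_unfold)
  then show ?thesis
    unfolding translation_core_def
    using T h E by (intro open_equivalence_Int open_equivalence_left_core)
qed

lemma mem_translation_core_iff:
  assumes "closed_op A h"
  shows "(x, y) \<in> translation_core A h E \<longleftrightarrow>
    x \<in> A \<and> y \<in> A \<and> (x, y) \<in> E \<and> (\<forall>a\<in>A. (h a x, h a y) \<in> E) \<and> (\<forall>b\<in>A. (h x b, h y b) \<in> E)
    \<and> (\<forall>a\<in>A. \<forall>b\<in>A. (h (h a x) b, h (h a y) b) \<in> E)"
  using assms by (auto simp: translation_core_def left_core_def closed_op_def)

text \<open>By associativity, following a translation \<open>x \<mapsto> c x\<close> or \<open>x \<mapsto> x c\<close> by one of the four forms
  of translation gives one of the four forms again.\<close>

lemma compatible_translation_core: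
  assumes h: "closed_op A h" and "associative_on A h"
  shows "compatible A h (translation_core A h E)"
proof -
  have closed: "h x y \<in> A" if "x \<in> A" "y \<in> A" for x y
    using h that by (simp add: closed_op_def)
  have assoc: "h x (h y z) = h (h x y) z" if "x \<in> A" "y \<in> A" "z \<in> A" for x y z
    using assms(2) that by (simp add: associative_on_def)
  have "(h c x, h c y) \<in> translation_core A h E \<and> (h x c, h y c) \<in> translation_core A h E"
    if xy: "(x, y) \<in> translation_core A h E" and c: "c \<in> A" for x y c
  proof -
    have A: "x \<in> A" "y \<in> A"
      using xy by (simp_all add: mem_translation_core_iff[OF h])
    have left: "(h a x, h a y) \<in> E" if "a \<in> A" for a
      using xy that by (simp add: mem_translation_core_iff[OF h])
    have right: "(h x b, h y b) \<in> E" if "b \<in> A" for b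
      using xy that by (simp add: mem_translation_core_iff[OF h])
    have both: "(h (h a x) b, h (h a y) b) \<in> E" if "a \<in> A" "b \<in> A" for a b
      using xy that by (simp add: mem_translation_core_iff[OF h])
    have "(h c x, h c y) \<in> translation_core A h E"
      using A c left both by (simp add: mem_translation_core_iff[OF h] closed assoc)
    moreover have "(h x c, h y c) \<in> translation_core A h E"
      using A c both right right[OF closed[OF c]] both[OF _ closed[OF c]]
      by (simp add: mem_translation_core_iff[OF h] closed assoc)
    ultimately show ?thesis ..
  qed
  then show ?thesis
    by (simp add: compatible_def)
qed

text \<open>By distributivity \<open>h a\<close> maps a \<open>g\<close>-translation of \<open>x\<close> to a \<open>g\<close>-translation of \<open>h a x\<close>.\<close>

lemma compatible_left_core:
  assumes "compatible A g E" "closed_op A h" "closed_op A g"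
    and "\<forall>x\<in>A. \<forall>y\<in>A. \<forall>z\<in>A. h x (g y z) = g (h x y) (h x z)"
  shows "compatible A g (left_core A h E)"
  using assms by (simp add: compatible_def left_core_def closed_op_def)

lemma compatible_translation_core_of_distributes:
  assumes "compatible A g E" "closed_op A h" "closed_op A g" "distributes_on A h g"
  shows "compatible A g (translation_core A h E)"
proof -
  have L: "compatible A g (left_core A h E')" if "compatible A g E'" for E'
    using that assms by (intro compatible_left_core) (auto simp: distributes_on_def)
  have R: "compatible A g (left_core A (\<lambda>x y. h y x) E)"
    using assms by (intro compatible_left_core) (auto simp: distributes_on_def closed_op_def)
  show ?thesis
    using assms(1) L[OF assms(1)] R L[OF R]
    by (simp add: compatible_def translation_core_def)
qed

lemma compatible2:
  assumes "equiv A E" "compatible A h E" "(x, x') \<in> E" "(y, y') \<in> E"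
  shows "(h x y, h x' y') \<in> E"
proof -
  have "x' \<in> A" "y \<in> A"
    using assms(1,3,4) by (auto simp: equiv_def)
  then have "(h x y, h x' y) \<in> E" "(h x' y, h x' y') \<in> E"
    using assms(2-4) by (simp_all add: compatible_def)
  then show ?thesis
    using assms(1) by (meson equiv_def transD)
qed

section \<open>Open congruences of compact algebras\<close>

definition congruence :: "'f variety \<Rightarrow> 'a set \<Rightarrow> ('f, 'a) interp \<Rightarrow> ('a \<times> 'a) set \<Rightarrow> bool" where
  "congruence F A I E \<longleftrightarrow> equiv A E \<and>
     (\<forall>f\<in>symbols F. \<forall>xs\<in>tuples (arity F f) A. \<forall>ys\<in>tuples (arity F f) A.
        list_all2 (\<lambda>x y. (x, y) \<in> E) xs ys \<longrightarrow> (I f xs, I f ys) \<in> E)"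

lemma congruence_op_arityI:
  assumes "arity F = op_arity" and E: "equiv A E" and "closed_under F A I"
    and bin: "\<And>f. f \<in> symbols F \<Longrightarrow> op_arity f = 2 \<Longrightarrow> compatible A (\<lambda>x y. I f [x, y]) E"
    and un: "\<And>f x y. f \<in> symbols F \<Longrightarrow> op_arity f = 1 \<Longrightarrow> (x, y) \<in> E \<Longrightarrow> (I f [x], I f [y]) \<in> E"
  shows "congruence F A I E"
  unfolding congruence_def
proof (intro conjI ballI impI)
  fix f xs ys
  assume f: "f \<in> symbols F" and xs: "xs \<in> tuples (arity F f) A" and ys: "ys \<in> tuples (arity F f) A"
    and xy: "list_all2 (\<lambda>x y. (x, y) \<in> E) xs ys"
  consider "op_arity f = 0" | "op_arity f = 1" | "op_arity f = 2"
    by (cases f) auto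
  then show "(I f xs, I f ys) \<in> E"
  proof cases
    case 1
    then have "xs = []" "ys = []"
      using xs ys assms(1) by (auto simp: tuples_def)
    moreover have "I f xs \<in> A"
      using f xs assms(3) by (auto simp: closed_under_def)
    ultimately show ?thesis
      using E by (auto simp: equiv_def refl_on_def)
  next
    case 2
    then obtain x y where "xs = [x]" "ys = [y]"
      using xs ys assms(1) by (auto simp: tuples_def length_Suc_conv)
    then show ?thesis
      using un[OF f 2] xy by simp
  next
    case 3
    then obtain x x' y y' where "xs = [x, x']" "ys = [y, y']"
      using xs ys assms(1) by (auto simp: tuples_def length_Suc_conv numeral_2_eq_2)
    then show ?thesis
      using compatible2[OF E bin[OF f 3]] xy by simp
  qed
qed (rule E)

lemma identity_holds:
  assumes "in_variety F A I" "(s, t) \<in> identities F" "x \<in> A" "y \<in> A" "z \<in> A"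
  shows "eval I (\<lambda>n. if n = 0 then x else if n = 1 then y else z) s
       = eval I (\<lambda>n. if n = 0 then x else if n = 1 then y else z) t"
proof -
  have "\<forall>v. range v \<subseteq> A \<longrightarrow> eval I v s = eval I v t"
    using assms(1,2) by (auto simp: in_variety_def)
  moreover have "range (\<lambda>n :: nat. if n = 0 then x else if n = 1 then y else z) \<subseteq> A"
    using assms(3-5) by auto
  ultimately show ?thesis
    by blast
qed


text \<open>Multiplying \<open>x\<close> and \<open>y\<close> by the inverse of \<open>x\<close> on the left and by the inverse of \<open>y\<close> on the
  right gives the inverses of \<open>y\<close> and \<open>x\<close>.\<close>

lemma inverse_respects_compatible:
  assumes E: "equiv A E" and h: "compatible A h E" "closed_op A h" "associative_on A h"
    and e: "e \<in> A" "\<And>x. x \<in> A \<Longrightarrow> h e x = x" "\<And>x. x \<in> A \<Longrightarrow> h x e = x"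
    and inv: "\<And>x. x \<in> A \<Longrightarrow> i x \<in> A" "\<And>x. x \<in> A \<Longrightarrow> h (i x) x = e" "\<And>x. x \<in> A \<Longrightarrow> h x (i x) = e"
    and xy: "(x, y) \<in> E"
  shows "(i x, i y) \<in> E"
proof -
  have A: "x \<in> A" "y \<in> A"
    using E xy by (auto simp: equiv_def)
  have "(h x (i y), h y (i y)) \<in> E"
    using h(1) xy A inv(1) by (simp add: compatible_def)
  then have "(h (i x) (h x (i y)), h (i x) (h y (i y))) \<in> E"
    using h(1) A inv(1) by (simp add: compatible_def)
  moreover have "h (i x) (h x (i y)) = h (h (i x) x) (i y)"
    using h(3) A inv(1) by (simp add: associative_on_def)
  ultimately have "(i y, i x) \<in> E"
    using A inv e by simp
  then show ?thesis
    using E by (meson equiv_def symD)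
qed

text \<open>Writing \<open>x'\<close> for the complement, \<open>x' = x' \<and> (y \<or> y')\<close> is related to
  \<open>x' \<and> (x \<or> y') = x' \<and> y'\<close>, and by symmetry so is \<open>y'\<close>.\<close>

lemma complement_respects_compatible:
  assumes E: "equiv A E" and compat: "compatible A meet E" "compatible A join E"
    and closed: "closed_op A meet" "closed_op A join" "\<And>x. x \<in> A \<Longrightarrow> c x \<in> A"
    and distrib: "distributes_on A meet join"
    and comm: "\<And>x y. x \<in> A \<Longrightarrow> y \<in> A \<Longrightarrow> meet x y = meet y x"
      "\<And>x y. x \<in> A \<Longrightarrow> y \<in> A \<Longrightarrow> join x y = join y x"
    and one: "\<And>x. x \<in> A \<Longrightarrow> meet x one = x" and zero: "\<And>x. x \<in> A \<Longrightarrow> join x zero = x" "zero \<in> A"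
    and compl: "\<And>x. x \<in> A \<Longrightarrow> meet x (c x) = zero" "\<And>x. x \<in> A \<Longrightarrow> join x (c x) = one"
    and xy: "(x, y) \<in> E"
  shows "(c x, c y) \<in> E"
proof -
  have half: "(meet (c u) (c v), c u) \<in> E" if uv: "(u, v) \<in> E" for u v
  proof -
    have A: "u \<in> A" "v \<in> A" "c u \<in> A" "c v \<in> A" "meet (c u) (c v) \<in> A"
      using E uv closed by (auto simp: equiv_def closed_op_def)
    have "(join u (c v), join v (c v)) \<in> E"
      using compat(2) uv A by (simp add: compatible_def)
    then have "(meet (c u) (join u (c v)), meet (c u) (join v (c v))) \<in> E"
      using compat(1) A by (simp add: compatible_def)
    moreover have "meet (c u) (join v (c v)) = c u"
      using compl(2) one A by simp
    moreover have "meet (c u) (join u (c v)) = join (meet (c u) u) (meet (c u) (c v))"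
      using distrib A by (simp add: distributes_on_def)
    moreover have "meet (c u) u = zero"
      using comm(1)[of "c u" u] compl(1) A by simp
    moreover have "join zero (meet (c u) (c v)) = meet (c u) (c v)"
      using comm(2)[of zero] zero A by simp
    ultimately show ?thesis
      by simp
  qed
  have "(y, x) \<in> E"
    using E xy by (meson equiv_def symD)
  moreover have "meet (c y) (c x) = meet (c x) (c y)"
    using comm(1) closed(3) E xy by (auto simp: equiv_def)
  ultimately have "(meet (c x) (c y), c y) \<in> E"
    using half[of y x] by simp
  with half[OF xy] show ?thesis
    using E by (meson equiv_def symD transD)
qed

lemma open_compatible_refinement:
  assumes T: "compact_space T" and E0: "open_equivalence T E0"
    and h: "continuous_map (prod_topology T T) T (\<lambda>(a, x). h a x)" "associative_on (topspace T) h"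
  obtains E where "E \<subseteq> E0" "open_equivalence T E" "compatible (topspace T) h E"
  using open_equivalence_translation_core[OF T h(1) E0] translation_core_subset
    compatible_translation_core[OF continuous_imp_closed_op[OF h(1)] h(2)]
  by metis

lemma open_compatible_refinement2:
  assumes T: "compact_space T" and E0: "open_equivalence T E0"
    and g: "continuous_map (prod_topology T T) T (\<lambda>(a, x). g a x)" "associative_on (topspace T) g"
    and h: "continuous_map (prod_topology T T) T (\<lambda>(a, x). h a x)" "associative_on (topspace T) h"
    and distrib: "distributes_on (topspace T) h g"
  obtains E where "E \<subseteq> E0" "open_equivalence T E" "compatible (topspace T) g E"
    "compatible (topspace T) h E"
proof -
  note closed = continuous_imp_closed_op[OF g(1)] continuous_imp_closed_op[OF h(1)]
  obtain E1 where E1: "E1 \<subseteq> E0" "open_equivalence T E1" "compatible (topspace T) g E1"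
    using open_compatible_refinement[OF T E0 g] by metis
  show ?thesis
  proof (rule that)
    show "translation_core (topspace T) h E1 \<subseteq> E0"
      using translation_core_subset E1(1) by (rule subset_trans)
    show "open_equivalence T (translation_core (topspace T) h E1)"
      using T h(1) E1(2) by (rule open_equivalence_translation_core)
    show "compatible (topspace T) g (translation_core (topspace T) h E1)"
      using E1(3) closed(2,1) distrib by (rule compatible_translation_core_of_distributes)
    show "compatible (topspace T) h (translation_core (topspace T) h E1)"
      using closed(2) h(2) by (rule compatible_translation_core)
  qed
qed

lemma semigroup_associative:
  assumes "in_variety F A I" "identities semigroups \<subseteq> identities F"
  shows "associative_on A (\<lambda>x y. I Times [x, y])"
  unfolding associative_on_def
proof (intro ballI)
  fix x y z assume A: "x \<in> A" "y \<in> A" "z \<in> A"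
  show "I Times [I Times [x, y], z] = I Times [x, I Times [y, z]]"
    using identity_holds[OF assms(1) _ A, of "ttimes (ttimes vx vy) vz" "ttimes vx (ttimes vy vz)"]
      assms(2) by (simp add: semigroups_def)
qed

lemma lattice_laws:
  assumes "in_variety F A I" "identities distributive_lattices \<subseteq> identities F"
    and closed: "closed_op A (\<lambda>x y. I Join [x, y])"
  shows "associative_on A (\<lambda>x y. I Meet [x, y])" "associative_on A (\<lambda>x y. I Join [x, y])"
    and "distributes_on A (\<lambda>x y. I Meet [x, y]) (\<lambda>x y. I Join [x, y])"
    and "\<And>x y. x \<in> A \<Longrightarrow> y \<in> A \<Longrightarrow> I Meet [x, y] = I Meet [y, x]"
    and "\<And>x y. x \<in> A \<Longrightarrow> y \<in> A \<Longrightarrow> I Join [x, y] = I Join [y, x]"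
proof -
  note holds = identity_holds[OF assms(1)]
  show comm: "I Meet [x, y] = I Meet [y, x]" if "x \<in> A" "y \<in> A" for x y
    using holds[of "tmeet vx vy" "tmeet vy vx" x y x] that assms(2)
    by (simp add: distributive_lattices_def)
  show "I Join [x, y] = I Join [y, x]" if "x \<in> A" "y \<in> A" for x y
    using holds[of "tjoin vx vy" "tjoin vy vx" x y x] that assms(2)
    by (simp add: distributive_lattices_def)
  show "associative_on A (\<lambda>x y. I Meet [x, y])"
    unfolding associative_on_def
  proof (intro ballI)
    fix x y z assume A: "x \<in> A" "y \<in> A" "z \<in> A"
    show "I Meet [I Meet [x, y], z] = I Meet [x, I Meet [y, z]]"
      using holds[OF _ A, of "tmeet (tmeet vx vy) vz" "tmeet vx (tmeet vy vz)"] assms(2)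
      by (simp add: distributive_lattices_def)
  qed
  show "associative_on A (\<lambda>x y. I Join [x, y])"
    unfolding associative_on_def
  proof (intro ballI)
    fix x y z assume A: "x \<in> A" "y \<in> A" "z \<in> A"
    show "I Join [I Join [x, y], z] = I Join [x, I Join [y, z]]"
      using holds[OF _ A, of "tjoin (tjoin vx vy) vz" "tjoin vx (tjoin vy vz)"] assms(2)
      by (simp add: distributive_lattices_def)
  qed
  show "distributes_on A (\<lambda>x y. I Meet [x, y]) (\<lambda>x y. I Join [x, y])"
    unfolding distributes_on_def
  proof (intro ballI)
    have left: "I Meet [x, I Join [y, z]] = I Join [I Meet [x, y], I Meet [x, z]]"
      if "x \<in> A" "y \<in> A" "z \<in> A" for x y z
      using holds[OF _ that, of "tmeet vx (tjoin vy vz)" "tjoin (tmeet vx vy) (tmeet vx vz)"] assms(2)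
      by (simp add: distributive_lattices_def)
    fix x y z assume A: "x \<in> A" "y \<in> A" "z \<in> A"
    have "I Join [x, y] \<in> A"
      using closed A by (simp add: closed_op_def)
    then have "I Meet [I Join [x, y], z] = I Join [I Meet [x, z], I Meet [y, z]]"
      using left[of z x y] comm A by simp
    with left[OF A] show "I Meet [x, I Join [y, z]] = I Join [I Meet [x, y], I Meet [x, z]] \<and>
        I Meet [I Join [x, y], z] = I Join [I Meet [x, z], I Meet [y, z]]" ..
  qed
qed

lemma ring_laws:
  assumes "in_variety F A I" "identities rings \<subseteq> identities F"
  shows "associative_on A (\<lambda>x y. I Plus [x, y])"
    and "distributes_on A (\<lambda>x y. I Times [x, y]) (\<lambda>x y. I Plus [x, y])"
    and "\<And>x y. x \<in> A \<Longrightarrow> y \<in> A \<Longrightarrow> I Plus [x, y] = I Plus [y, x]"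
    and "\<And>x. x \<in> A \<Longrightarrow> I Plus [x, I Zero []] = x"
    and "\<And>x. x \<in> A \<Longrightarrow> I Plus [x, I Minus [x]] = I Zero []"
proof -
  note holds = identity_holds[OF assms(1)]
  show "I Plus [x, y] = I Plus [y, x]" if "x \<in> A" "y \<in> A" for x y
    using holds[of "tplus vx vy" "tplus vy vx" x y x] that assms(2) by (simp add: rings_def)
  show "I Plus [x, I Zero []] = x" if "x \<in> A" for x
    using holds[of "tplus vx tzero" vx x x x] that assms(2) by (simp add: rings_def)
  show "I Plus [x, I Minus [x]] = I Zero []" if "x \<in> A" for x
    using holds[of "tplus vx (tminus vx)" tzero x x x] that assms(2) by (simp add: rings_def)
  show "associative_on A (\<lambda>x y. I Plus [x, y])"
    unfolding associative_on_def
  proof (intro ballI)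
    fix x y z assume A: "x \<in> A" "y \<in> A" "z \<in> A"
    show "I Plus [I Plus [x, y], z] = I Plus [x, I Plus [y, z]]"
      using holds[OF _ A, of "tplus (tplus vx vy) vz" "tplus vx (tplus vy vz)"] assms(2)
      by (simp add: rings_def)
  qed
  show "distributes_on A (\<lambda>x y. I Times [x, y]) (\<lambda>x y. I Plus [x, y])"
    unfolding distributes_on_def
  proof (intro ballI conjI)
    fix x y z assume A: "x \<in> A" "y \<in> A" "z \<in> A"
    show "I Times [x, I Plus [y, z]] = I Plus [I Times [x, y], I Times [x, z]]"
      using holds[OF _ A, of "ttimes vx (tplus vy vz)" "tplus (ttimes vx vy) (ttimes vx vz)"]
        assms(2) by (simp add: rings_def)
    show "I Times [I Plus [x, y], z] = I Plus [I Times [x, z], I Times [y, z]]"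
      using holds[OF _ A, of "ttimes (tplus vx vy) vz" "tplus (ttimes vx vz) (ttimes vy vz)"]
        assms(2) by (simp add: rings_def)
  qed
qed

lemma closed_under_nullary:
  assumes "closed_under F A I" "f \<in> symbols F" "arity F f = 0"
  shows "I f [] \<in> A"
  using assms by (simp add: closed_under_def tuples_def)

lemma closed_under_unary:
  assumes "closed_under F A I" "f \<in> symbols F" "arity F f = 1" "x \<in> A"
  shows "I f [x] \<in> A"
  using assms by (simp add: closed_under_def tuples_def)

text \<open>In these varieties every operation other than multiplication is a constant or the inverse,
  so a congruence for the multiplication alone is a congruence.\<close>

lemma open_congruence_multiplicative:
  assumes F: "F \<in> {semigroups, monoids, groups}"
    and var: "in_variety F (topspace T) I"
    and T: "compact_space T" and E0: "open_equivalence T E0"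
    and cont: "continuous_map (prod_topology T T) T (\<lambda>(a, x). I Times [a, x])"
  shows "\<exists>E\<subseteq>E0. open_equivalence T E \<and> congruence F (topspace T) I E"
proof -
  let ?A = "topspace T"
  have closed: "closed_under F ?A I"
    using var by (simp add: in_variety_def)
  have "identities semigroups \<subseteq> identities F"
    using F by (auto simp: monoids_def groups_def)
  from semigroup_associative[OF var this]
  have assoc: "associative_on ?A (\<lambda>x y. I Times [x, y])" .
  obtain E where E: "E \<subseteq> E0" "open_equivalence T E" "compatible ?A (\<lambda>x y. I Times [x, y]) E"
    using open_compatible_refinement[OF T E0 cont assoc] .
  have equiv: "equiv ?A E"
    using E(2) by (simp add: open_equivalence_def)
  have "congruence F ?A I E"
  proof (rule congruence_op_arityI[OF _ equiv closed])
    show "arity F = op_arity"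
      using F by (auto simp: semigroups_def monoids_def groups_def)
    show "compatible ?A (\<lambda>x y. I f [x, y]) E" if "f \<in> symbols F" "op_arity f = 2" for f
      using that F E(3) by (auto simp: semigroups_def monoids_def groups_def)
    show "(I f [x], I f [y]) \<in> E" if f: "f \<in> symbols F" "op_arity f = 1" and xy: "(x, y) \<in> E" for f x y
    proof -
      have groups: "F = groups" "f = Inv"
        using f F by (auto simp: semigroups_def monoids_def groups_def)
      note holds = identity_holds[OF var]
      have "(I Inv [x], I Inv [y]) \<in> E"
      proof (rule inverse_respects_compatible[where i = "\<lambda>u. I Inv [u]" and e = "I opsym.One []",
            OF equiv E(3) continuous_imp_closed_op[OF cont] assoc])
        show "I opsym.One [] \<in> ?A"
          using closed_under_nullary[OF closed] groups(1) by (simp add: groups_def)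
        show "I Inv [u] \<in> ?A" if "u \<in> ?A" for u
          using closed_under_unary[OF closed] groups(1) that by (simp add: groups_def)
        show "I Times [I opsym.One [], u] = u" if "u \<in> ?A" for u
          using holds[of "ttimes tone vx" vx u u u] groups(1) that
          by (simp add: groups_def monoids_def)
        show "I Times [u, I opsym.One []] = u" if "u \<in> ?A" for u
          using holds[of "ttimes vx tone" vx u u u] groups(1) that
          by (simp add: groups_def monoids_def)
        show "I Times [I Inv [u], u] = I opsym.One []" if "u \<in> ?A" for u
          using holds[of "ttimes (tinv vx) vx" tone u u u] groups(1) that by (simp add: groups_def)
        show "I Times [u, I Inv [u]] = I opsym.One []" if "u \<in> ?A" for u
          using holds[of "ttimes vx (tinv vx)" tone u u u] groups(1) that by (simp add: groups_def)
      qed (rule xy)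
      with groups(2) show ?thesis
        by simp
    qed
  qed
  with E show ?thesis
    by blast
qed

text \<open>The additive translations come first: multiplication distributes over addition, so making
  the relation compatible with multiplication afterwards keeps it compatible with addition.\<close>

lemma open_congruence_ring:
  assumes F: "F \<in> {rings, unital_rings}"
    and var: "in_variety F (topspace T) I"
    and T: "compact_space T" and E0: "open_equivalence T E0"
    and plus: "continuous_map (prod_topology T T) T (\<lambda>(a, x). I Plus [a, x])"
    and times: "continuous_map (prod_topology T T) T (\<lambda>(a, x). I Times [a, x])"
  shows "\<exists>E\<subseteq>E0. open_equivalence T E \<and> congruence F (topspace T) I E"
proof -
  let ?A = "topspace T"
  have closed: "closed_under F ?A I"
    using var by (simp add: in_variety_def)
  have ids: "identities semigroups \<subseteq> identities F" "identities rings \<subseteq> identities F"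
    using F by (auto simp: rings_def unital_rings_def)
  note laws = ring_laws[OF var ids(2)]
  obtain E where E: "E \<subseteq> E0" "open_equivalence T E" "compatible ?A (\<lambda>x y. I Plus [x, y]) E"
      "compatible ?A (\<lambda>x y. I Times [x, y]) E"
    using open_compatible_refinement2[OF T E0 plus laws(1) times semigroup_associative[OF var ids(1)] laws(2)] .
  have equiv: "equiv ?A E"
    using E(2) by (simp add: open_equivalence_def)
  have "congruence F ?A I E"
  proof (rule congruence_op_arityI[OF _ equiv closed])
    show "arity F = op_arity"
      using F by (auto simp: rings_def unital_rings_def)
    show "compatible ?A (\<lambda>x y. I f [x, y]) E" if "f \<in> symbols F" "op_arity f = 2" for f
      using that F E(3,4) by (auto simp: rings_def unital_rings_def)
    show "(I f [x], I f [y]) \<in> E" if f: "f \<in> symbols F" "op_arity f = 1" and xy: "(x, y) \<in> E" for f x y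
    proof -
      have zero: "I Zero [] \<in> ?A"
        using closed_under_nullary[OF closed] F by (auto simp: rings_def unital_rings_def)
      have minus: "I Minus [u] \<in> ?A" if "u \<in> ?A" for u
        using closed_under_unary[OF closed] F that by (auto simp: rings_def unital_rings_def)
      have "(I Minus [x], I Minus [y]) \<in> E"
      proof (rule inverse_respects_compatible[where i = "\<lambda>u. I Minus [u]",
            OF equiv E(3) continuous_imp_closed_op[OF plus] laws(1) zero])
        show "I Plus [I Zero [], u] = u" if "u \<in> ?A" for u
          using laws(3)[OF zero that] laws(4)[OF that] by simp
        show "I Plus [I Minus [u], u] = I Zero []" if "u \<in> ?A" for u
          using laws(3)[OF minus[OF that] that] laws(5)[OF that] by simp
        show "I Minus [u] \<in> ?A" if "u \<in> ?A" for u
          using that by (rule minus)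
        show "I Plus [u, I Zero []] = u" if "u \<in> ?A" for u
          using that by (rule laws(4))
        show "I Plus [u, I Minus [u]] = I Zero []" if "u \<in> ?A" for u
          using that by (rule laws(5))
      qed (rule xy)
      moreover have "f = Minus"
        using f F by (auto simp: rings_def unital_rings_def)
      ultimately show ?thesis
        by simp
    qed
  qed
  with E show ?thesis
    by blast
qed

text \<open>A distributive lattice is treated like a ring with \<open>\<or>\<close> as addition and \<open>\<and>\<close> as
  multiplication.\<close>

lemma open_congruence_lattice:
  assumes F: "F \<in> {distributive_lattices, boolean_algebras}"
    and var: "in_variety F (topspace T) I"
    and T: "compact_space T" and E0: "open_equivalence T E0"
    and meet: "continuous_map (prod_topology T T) T (\<lambda>(a, x). I Meet [a, x])"
    and join: "continuous_map (prod_topology T T) T (\<lambda>(a, x). I Join [a, x])"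
  shows "\<exists>E\<subseteq>E0. open_equivalence T E \<and> congruence F (topspace T) I E"
proof -
  let ?A = "topspace T"
  have closed: "closed_under F ?A I"
    using var by (simp add: in_variety_def)
  have ids: "identities distributive_lattices \<subseteq> identities F"
    using F by (auto simp: boolean_algebras_def)
  note laws = lattice_laws[OF var ids continuous_imp_closed_op[OF join]]
  obtain E where E: "E \<subseteq> E0" "open_equivalence T E" "compatible ?A (\<lambda>x y. I Join [x, y]) E"
      "compatible ?A (\<lambda>x y. I Meet [x, y]) E"
    using open_compatible_refinement2[OF T E0 join laws(2) meet laws(1,3)] .
  have equiv: "equiv ?A E"
    using E(2) by (simp add: open_equivalence_def)
  have "congruence F ?A I E"
  proof (rule congruence_op_arityI[OF _ equiv closed])
    show "arity F = op_arity"
      using F by (auto simp: distributive_lattices_def boolean_algebras_def)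
    show "compatible ?A (\<lambda>x y. I f [x, y]) E" if "f \<in> symbols F" "op_arity f = 2" for f
      using that F E(3,4) by (auto simp: distributive_lattices_def boolean_algebras_def)
    show "(I f [x], I f [y]) \<in> E" if f: "f \<in> symbols F" "op_arity f = 1" and xy: "(x, y) \<in> E" for f x y
    proof -
      have "F \<noteq> distributive_lattices"
        using f by (auto simp: distributive_lattices_def)
      with F have boolean: "F = boolean_algebras"
        by simp
      with f have Compl: "f = Compl"
        by (auto simp: boolean_algebras_def)
      note holds = identity_holds[OF var]
      have "(I Compl [x], I Compl [y]) \<in> E"
      proof (rule complement_respects_compatible[where c = "\<lambda>u. I Compl [u]" and one = "I Top []"
            and zero = "I Bot []", OF equiv E(4,3)
            continuous_imp_closed_op[OF meet] continuous_imp_closed_op[OF join] _ laws(3-5)])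
        show "I Compl [u] \<in> ?A" if "u \<in> ?A" for u
          using closed_under_unary[OF closed] boolean that by (simp add: boolean_algebras_def)
        show "I Bot [] \<in> ?A"
          using closed_under_nullary[OF closed] boolean by (simp add: boolean_algebras_def)
        show "I Meet [u, I Top []] = u" if "u \<in> ?A" for u
          using holds[of "tmeet vx ttop" vx u u u] boolean that
          by (simp add: boolean_algebras_def)
        show "I Join [u, I Bot []] = u" if "u \<in> ?A" for u
          using holds[of "tjoin vx tbot" vx u u u] boolean that
          by (simp add: boolean_algebras_def)
        show "I Meet [u, I Compl [u]] = I Bot []" if "u \<in> ?A" for u
          using holds[of "tmeet vx (tcompl vx)" tbot u u u] boolean that
          by (simp add: boolean_algebras_def)
        show "I Join [u, I Compl [u]] = I Top []" if "u \<in> ?A" for u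
          using holds[of "tjoin vx (tcompl vx)" ttop u u u] boolean that
          by (simp add: boolean_algebras_def)
      qed (simp_all add: xy)
      with Compl show ?thesis
        by simp
    qed
  qed
  with E show ?thesis
    by blast
qed

lemma open_congruence_exists:
  assumes F: "F \<in> {distributive_lattices, boolean_algebras, rings, unital_rings,
                semigroups, monoids, groups}"
    and var: "in_variety F (topspace T) I"
    and T: "compact_space T" and E0: "open_equivalence T E0"
    and cont: "\<And>f. f \<in> symbols F \<Longrightarrow> op_arity f = 2 \<Longrightarrow>
      continuous_map (prod_topology T T) T (\<lambda>(a, x). I f [a, x])"
  shows "\<exists>E\<subseteq>E0. open_equivalence T E \<and> congruence F (topspace T) I E"
proof -
  consider "F \<in> {semigroups, monoids, groups}" | "F \<in> {rings, unital_rings}"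
    | "F \<in> {distributive_lattices, boolean_algebras}"
    using F by blast
  then show ?thesis
  proof cases
    case 1
    then have "Times \<in> symbols F"
      by (auto simp: semigroups_def monoids_def groups_def)
    then show ?thesis
      using cont by (intro open_congruence_multiplicative[OF 1 var T E0]) simp_all
  next
    case 2
    then have "Plus \<in> symbols F" "Times \<in> symbols F"
      by (auto simp: rings_def unital_rings_def)
    then show ?thesis
      using cont by (intro open_congruence_ring[OF 2 var T E0]) simp_all
  next
    case 3
    then have "Meet \<in> symbols F" "Join \<in> symbols F"
      by (auto simp: distributive_lattices_def boolean_algebras_def)
    then show ?thesis
      using cont by (intro open_congruence_lattice[OF 3 var T E0]) simp_all
  qed
qed

section \<open>Finite quotients of algebras\<close>

text \<open>Terms need not respect arities, while closure and the homomorphism property say nothing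
  about argument lists of the wrong length. Identities pass to homomorphic images for terms that
  do respect them.\<close>

fun wf_trm :: "'f variety \<Rightarrow> 'f trm \<Rightarrow> bool" where
  "wf_trm F (Var n) \<longleftrightarrow> True"
| "wf_trm F (App f ts) \<longleftrightarrow> f \<in> symbols F \<and> length ts = arity F f \<and> (\<forall>t\<in>set ts. wf_trm F t)"

definition wf_identities :: "'f variety \<Rightarrow> bool" where
  "wf_identities F \<longleftrightarrow> (\<forall>(s, t)\<in>identities F. wf_trm F s \<and> wf_trm F t)"

lemma eval_mem_and_morphism:
  assumes "closed_under F A I" "morphism F A I B J c" "range v \<subseteq> A" "wf_trm F t"
  shows "eval I v t \<in> A \<and> eval J (c \<circ> v) t = c (eval I v t)"
  using assms(4)
proof (induction t)
  case (Var n)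
  then show ?case
    using assms(3) by auto
next
  case (App f ts)
  have IH: "eval I v t \<in> A" "eval J (c \<circ> v) t = c (eval I v t)" if "t \<in> set ts" for t
    using App.IH[OF that] App.prems that by (simp_all add: o_def)
  have "map (eval I v) ts \<in> tuples (arity F f) A" "f \<in> symbols F"
    using App.prems IH(1) by (auto simp: tuples_def)
  moreover have "map (eval J (c \<circ> v)) ts = map c (map (eval I v) ts)"
    using IH(2) by simp
  ultimately show ?case
    using assms(1,2) by (simp add: closed_under_def morphism_def o_def del: map_map)
qed

lemma tuples_image: "tuples n (c ` A) = map c ` tuples n A"
proof (intro equalityI subsetI)
  fix ys
  assume ys: "ys \<in> tuples n (c ` A)"
  then have "map c (map (inv_into A c) ys) = ys"
    by (auto simp: tuples_def o_def f_inv_into_f subset_iff intro!: map_idI)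
  moreover have "map (inv_into A c) ys \<in> tuples n A"
    using ys by (auto simp: tuples_def intro!: inv_into_into)
  ultimately show "ys \<in> map c ` tuples n A"
    by (metis imageI)
qed (force simp: tuples_def)

text \<open>A valuation in the image lifts along \<open>c\<close> to a valuation in \<open>A\<close>, where the identity holds.\<close>

lemma in_variety_image:
  assumes wf: "wf_identities F" and var: "in_variety F A I"
    and c: "morphism F A I (c ` A) J c"
  shows "in_variety F (c ` A) J"
  unfolding in_variety_def
proof (intro conjI)
  have closed: "closed_under F A I"
    using var by (simp add: in_variety_def)
  show "closed_under F (c ` A) J"
    unfolding closed_under_def tuples_image
  proof (intro ballI)
    fix f ys
    assume f: "f \<in> symbols F" and "ys \<in> map c ` tuples (arity F f) A"
    then obtain xs where xs: "xs \<in> tuples (arity F f) A" "ys = map c xs"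
      by blast
    then have "J f ys = c (I f xs)"
      using c f by (simp add: morphism_def)
    with closed f xs(1) show "J f ys \<in> c ` A"
      by (simp add: closed_under_def)
  qed
  show "\<forall>(s, t)\<in>identities F. \<forall>v. range v \<subseteq> c ` A \<longrightarrow> eval J v s = eval J v t"
  proof clarify
    fix s t and v :: "nat \<Rightarrow> _"
    assume st: "(s, t) \<in> identities F" and v: "range v \<subseteq> c ` A"
    define w where "w = inv_into A c \<circ> v"
    have w: "range w \<subseteq> A"
      using v by (auto simp: w_def intro!: inv_into_into)
    have "c \<circ> w = v"
      using v by (auto simp: w_def fun_eq_iff intro!: f_inv_into_f)
    moreover have "eval I w s = eval I w t"
      using var st w by (auto simp: in_variety_def)
    moreover have "wf_trm F s" "wf_trm F t"
      using wf st by (auto simp: wf_identities_def)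
    ultimately show "eval J v s = eval J v t"
      using eval_mem_and_morphism[OF closed c w] by metis
  qed
qed

text \<open>The quotient algebra is carried by the values of an arbitrary function \<open>c\<close> whose kernel is
  the congruence, so that the classes can be named by natural numbers. An operation is evaluated on
  chosen representatives.\<close>

lemma quotient_morphism:
  assumes E: "congruence F A I E"
    and c: "\<And>x y. x \<in> A \<Longrightarrow> y \<in> A \<Longrightarrow> c x = c y \<longleftrightarrow> (x, y) \<in> E"
    and closed: "closed_under F A I"
  shows "morphism F A I (c ` A) (\<lambda>f ns. c (I f (map (inv_into A c) ns))) c"
  unfolding morphism_def
proof (intro conjI ballI)
  fix f xs
  assume f: "f \<in> symbols F" and xs: "xs \<in> tuples (arity F f) A"
  define ys where "ys = map (inv_into A c) (map c xs)"
  have ys: "ys \<in> tuples (arity F f) A"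
    using xs by (auto simp: ys_def tuples_def intro!: inv_into_into)
  have "(x, inv_into A c (c x)) \<in> E" if "x \<in> A" for x
    using that c[of x "inv_into A c (c x)"] by (simp add: f_inv_into_f inv_into_into)
  then have "list_all2 (\<lambda>x y. (x, y) \<in> E) xs ys"
    using xs by (force simp: ys_def tuples_def list_all2_conv_all_nth)
  then have "(I f xs, I f ys) \<in> E"
    using E f xs ys by (simp add: congruence_def)
  moreover have "I f xs \<in> A" "I f ys \<in> A"
    using closed f xs ys by (auto simp: closed_under_def)
  ultimately show "c (I f xs) = c (I f (map (inv_into A c) (map c xs)))"
    using c by (simp add: ys_def)
qed simp

lemma wf_identities_concrete:
  assumes "F \<in> {distributive_lattices, boolean_algebras, rings, unital_rings,
                semigroups, monoids, groups}"
  shows "wf_identities F"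
  using assms
  by (auto simp: wf_identities_def distributive_lattices_def boolean_algebras_def rings_def
      unital_rings_def semigroups_def monoids_def groups_def)

section \<open>Recoding a subshift by the classes of an open congruence\<close>

definition shift_by :: "int \<Rightarrow> (int \<Rightarrow> 's) \<Rightarrow> int \<Rightarrow> 's" where
  "shift_by i x = (\<lambda>j. x (j + i))"

lemma inj_shift: "inj shift"
proof (rule injI)
  fix x y :: "int \<Rightarrow> 's"
  assume "shift x = shift y"
  then have "shift x (j - 1) = shift y (j - 1)" for j
    by simp
  then show "x = y"
    by (simp add: shift_def fun_eq_iff)
qed

lemma shift_shift_by: "shift (shift_by i x) = shift_by (i + 1) x"
  by (simp add: shift_def shift_by_def fun_eq_iff algebra_simps)

lemma shift_by_shift: "shift_by i (shift x) = shift_by (i + 1) x"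
  by (simp add: shift_def shift_by_def fun_eq_iff algebra_simps)

lemma shift_by_0: "shift_by 0 x = x"
  by (simp add: shift_by_def)

text \<open>Going backwards uses that \<open>shift\<close> is injective and maps \<open>X\<close> onto itself.\<close>

lemma shift_by_mem:
  assumes "shift ` X = X" "x \<in> X"
  shows "shift_by i x \<in> X"
proof (induction i rule: int_induct[where k = 0])
  case base
  then show ?case
    using assms by (simp add: shift_by_0)
next
  case (step1 i)
  then have "shift (shift_by i x) \<in> shift ` X"
    by simp
  then show ?case
    by (simp only: assms(1) shift_shift_by)
next
  case (step2 i)
  then have "shift_by i x \<in> shift ` X"
    by (simp only: assms(1))
  then obtain z where "z \<in> X" "shift_by i x = shift z"
    by blast
  then have "shift (shift_by (i - 1) x) = shift z"
    by (simp add: shift_shift_by)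
  then have "shift_by (i - 1) x = z"
    by (rule injD[OF inj_shift])
  with \<open>z \<in> X\<close> show ?case
    by simp
qed

lemma shift_by_operation:
  assumes X: "shift ` X = X" and g: "\<And>xs. xs \<in> tuples n X \<Longrightarrow> g (map shift xs) = shift (g xs)"
    and xs: "xs \<in> tuples n X"
  shows "g (map (shift_by i) xs) = shift_by i (g xs)"
proof -
  have shifted: "map (shift_by i) xs \<in> tuples n X" for i
    using xs shift_by_mem[OF X] by (auto simp: tuples_def)
  have step: "g (map (shift_by (i + 1)) xs) = shift (g (map (shift_by i) xs))" for i
    using g[OF shifted[of i]] by (simp add: o_def shift_shift_by)
  show ?thesis
  proof (induction i rule: int_induct[where k = 0])
    case base
    then show ?case
      by (simp add: shift_by_0)
  next
    case (step1 i)
    then show ?case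
      by (simp add: step shift_shift_by)
  next
    case (step2 i)
    then have "shift (g (map (shift_by (i - 1)) xs)) = shift (shift_by (i - 1) (g xs))"
      using step[of "i - 1"] by (simp add: shift_shift_by)
    then show ?case
      by (rule injD[OF inj_shift])
  qed
qed

lemma compact_space_full_shift:
  assumes "finite S"
  shows "compact_space (full_shift S)"
  using assms by (simp add: full_shift_def compact_space_product_topology compact_space_discrete_topology)

lemma Hausdorff_space_full_shift: "Hausdorff_space (full_shift S)"
  by (simp add: full_shift_def Hausdorff_space_product_topology)

lemma continuous_map_shift_by:
  assumes "shift ` X = X"
  shows "continuous_map (subtopology (full_shift S) X) (subtopology (full_shift S) X) (shift_by i)"
proof -
  have "continuous_map (full_shift S) (full_shift S) (shift_by i)"
    unfolding full_shift_def continuous_map_componentwise_UNIV shift_by_def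
    by (auto intro: continuous_map_product_projection)
  then show ?thesis
    using shift_by_mem[OF assms]
    by (auto simp: continuous_map_in_subtopology intro: continuous_map_from_subtopology)
qed

lemma continuous_map_binary_block_operation:
  assumes "block_operation S X 2 g"
  defines "T \<equiv> subtopology (full_shift S) X"
  shows "continuous_map (prod_topology T T) T (\<lambda>(a, x). g [a, x])"
proof -
  \<comment> \<open>The two factors become a point of the product over \<open>{..<2}\<close>, which has to be undefined elsewhere.\<close>
  define m where "m = (\<lambda>p. \<lambda>i\<in>{..<2::nat}. if i = 0 then fst p else snd p :: int \<Rightarrow> 'a)"
  have "continuous_map (prod_topology T T) (product_topology (\<lambda>_. T) {..<2}) m"
    unfolding continuous_map_componentwise
    by (auto simp: m_def continuous_map_fst continuous_map_snd)
  moreover have "continuous_map (product_topology (\<lambda>_. T) {..<2}) T (\<lambda>x. g (map x [0..<2]))"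
    using assms(1) by (simp add: block_operation_def T_def)
  ultimately have "continuous_map (prod_topology T T) T ((\<lambda>x. g (map x [0..<2])) \<circ> m)"
    by (rule continuous_map_compose)
  moreover have "(\<lambda>x. g (map x [0..<2])) \<circ> m = (\<lambda>(a, x). g [a, x])"
    by (auto simp: fun_eq_iff m_def numeral_2_eq_2)
  ultimately show ?thesis
    by simp
qed

lemma open_equivalence_kernel:
  assumes "continuous_map T (discrete_topology S) q"
  shows "open_equivalence T {(x, y) \<in> topspace T \<times> topspace T. q x = q y}"
  unfolding open_equivalence_def
proof
  let ?A = "topspace T"
  show "equiv ?A {(x, y) \<in> ?A \<times> ?A. q x = q y}"
    by (intro equivI) (auto intro: refl_onI symI transI)
  have "continuous_map (prod_topology T T) (prod_topology (discrete_topology S) (discrete_topology S))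
      (\<lambda>p. (q (fst p), q (snd p)))"
    using continuous_map_compose[OF continuous_map_fst[of T T] assms]
      continuous_map_compose[OF continuous_map_snd[of T T] assms]
    by (simp add: continuous_map_pairwise o_def)
  moreover have "openin (prod_topology (discrete_topology S) (discrete_topology S)) (Id_on S)"
    by (auto simp flip: prod_topology_discrete_topology)
  ultimately have "openin (prod_topology T T)
      {p \<in> topspace (prod_topology T T). (q (fst p), q (snd p)) \<in> Id_on S}"
    by (rule openin_continuous_map_preimage)
  moreover have "q x \<in> S" if "x \<in> ?A" for x
    using continuous_map_funspace[OF assms] that by auto
  then have "{p \<in> topspace (prod_topology T T). (q (fst p), q (snd p)) \<in> Id_on S}
      = {(x, y) \<in> ?A \<times> ?A. q x = q y}"
    by (auto simp: Id_on_def)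
  ultimately show "openin (prod_topology T T) {(x, y) \<in> ?A \<times> ?A. q x = q y}"
    by simp
qed

text \<open>An open equivalence relation has finitely many classes, which are numbered here; the
  numbering is continuous because the classes are open.\<close>

lemma open_equivalence_coding:
  assumes "compact_space T" "open_equivalence T E"
  obtains c :: "'a \<Rightarrow> nat" where "finite (c ` topspace T)"
    "\<And>x y. x \<in> topspace T \<Longrightarrow> y \<in> topspace T \<Longrightarrow> c x = c y \<longleftrightarrow> (x, y) \<in> E"
    "continuous_map T (discrete_topology (c ` topspace T)) c"
proof -
  let ?A = "topspace T"
  have E: "equiv ?A E"
    using assms(2) by (simp add: open_equivalence_def)
  obtain e :: "'a set \<Rightarrow> nat" where e: "inj_on e (?A // E)"
    using finite_imp_inj_to_nat_seg[OF finite_quotient_open_equivalence[OF assms]] by metis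
  define c where "c = (\<lambda>x. e (E `` {x}))"
  have c: "c x = c y \<longleftrightarrow> (x, y) \<in> E" if "x \<in> ?A" "y \<in> ?A" for x y
    using that inj_on_eq_iff[OF e, of "E `` {x}" "E `` {y}"] eq_equiv_class_iff[OF E that]
    by (simp add: c_def quotientI)
  have "c ` ?A = e ` (?A // E)"
    by (auto simp: c_def quotient_def)
  then have "finite (c ` ?A)"
    using finite_quotient_open_equivalence[OF assms] by simp
  moreover have "continuous_map T (discrete_topology (c ` ?A)) c"
    unfolding continuous_map_def
  proof (intro conjI allI impI)
    fix U
    show "openin T {x \<in> ?A. c x \<in> U}"
    proof (subst openin_subopen, intro ballI)
      fix x
      assume x: "x \<in> {x \<in> ?A. c x \<in> U}"
      have "E `` {x} \<subseteq> {x \<in> ?A. c x \<in> U}"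
      proof
        fix y
        assume "y \<in> E `` {x}"
        then have "(x, y) \<in> E" "y \<in> ?A"
          using E by (auto simp: equiv_def)
        then show "y \<in> {x \<in> ?A. c x \<in> U}"
          using c[of x y] x by auto
      qed
      moreover have "x \<in> E `` {x}"
        using equiv_class_self[OF E] x by simp
      moreover have "openin T (E `` {x})"
        using open_equivalence_class[OF assms(2)] x by simp
      ultimately show "\<exists>V. openin T V \<and> x \<in> V \<and> V \<subseteq> {x \<in> ?A. c x \<in> U}"
        by blast
    qed
  qed auto
  ultimately show ?thesis
    using that[OF _ c] by blast
qed

text \<open>The recoding map sends \<open>x\<close> to the sequence of classes of its shifts. The hypothesis on
  coordinate \<open>0\<close> makes it injective, and compactness makes its image closed.\<close>

lemma cellwise_of_open_congruence:
  fixes S :: "'s set" and X :: "(int \<Rightarrow> 's) set"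
  defines "T \<equiv> subtopology (full_shift S) X"
  assumes X: "variety_subshift F S X I" and wf: "wf_identities F"
    and E: "open_equivalence T E" "congruence F X I E"
    and separates: "\<And>x y. (x, y) \<in> E \<Longrightarrow> x 0 = y 0"
  shows "\<exists>(R :: nat set) J Y \<phi>. cellwise_subshift F R J Y \<and>
    algebraic_conjugacy F S X I R Y (cellwise J) \<phi>"
proof -
  have sub: "subshift S X" and var: "in_variety F X I"
    and ops: "\<And>f. f \<in> symbols F \<Longrightarrow> block_operation S X (arity F f) (I f)"
    using X by (auto simp: variety_subshift_def)
  have closed: "closed_under F X I"
    using var by (simp add: in_variety_def)
  have XX: "shift ` X = X" and cl: "closedin (full_shift S) X" and S: "finite S"
    using sub by (auto simp: subshift_def)
  have top: "topspace T = X"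
    using closedin_subset[OF cl] by (auto simp: T_def)
  have "compactin (full_shift S) X"
    using closedin_compact_space[OF compact_space_full_shift[OF S] cl] .
  then have compact: "compact_space T"
    by (simp add: T_def compact_space_subtopology)
  obtain c :: "(int \<Rightarrow> 's) \<Rightarrow> nat" where finite: "finite (c ` X)"
    and c: "\<And>x y. x \<in> X \<Longrightarrow> y \<in> X \<Longrightarrow> c x = c y \<longleftrightarrow> (x, y) \<in> E"
    and cont: "continuous_map T (discrete_topology (c ` X)) c"
    using open_equivalence_coding[OF compact E(1), unfolded top] by blast
  define R where "R = c ` X"
  define J where "J = (\<lambda>f ns. c (I f (map (inv_into X c) ns)))"
  define \<phi> where "\<phi> = (\<lambda>x i. c (shift_by i x))"
  define Y where "Y = \<phi> ` X"
  have quot: "morphism F X I R J c"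
    unfolding R_def J_def using E(2) c closed by (rule quotient_morphism)
  have mor: "\<phi> (I f xs) = cellwise J f (map \<phi> xs)"
    if f: "f \<in> symbols F" and xs: "xs \<in> tuples (arity F f) X" for f xs
  proof
    fix i
    have "map (shift_by i) xs \<in> tuples (arity F f) X"
      using xs shift_by_mem[OF XX] by (auto simp: tuples_def)
    then have "c (I f (map (shift_by i) xs)) = J f (map c (map (shift_by i) xs))"
      using quot f by (simp add: morphism_def del: map_map)
    moreover have "I f (map (shift_by i) xs) = shift_by i (I f xs)"
      using ops[OF f] by (intro shift_by_operation[OF XX _ xs]) (simp add: block_operation_def)
    ultimately show "\<phi> (I f xs) i = cellwise J f (map \<phi> xs) i"
      by (simp add: \<phi>_def cellwise_def o_def)
  qed
  have inj: "inj_on \<phi> X"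
  proof (rule inj_onI)
    fix x y
    assume xy: "x \<in> X" "y \<in> X" "\<phi> x = \<phi> y"
    have "x i = y i" for i
    proof -
      have "c (shift_by i x) = c (shift_by i y)"
        using xy(3) by (simp add: \<phi>_def fun_eq_iff)
      then have "(shift_by i x, shift_by i y) \<in> E"
        using c shift_by_mem[OF XX] xy(1,2) by simp
      from separates[OF this] show ?thesis
        by (simp add: shift_by_def)
    qed
    then show "x = y" ..
  qed
  have shift: "\<phi> (shift x) = shift (\<phi> x)" for x
    by (simp only: \<phi>_def shift_by_shift) (simp add: shift_def)
  have cont\<phi>: "continuous_map T (full_shift R) \<phi>"
    unfolding full_shift_def continuous_map_componentwise_UNIV \<phi>_def R_def
    using continuous_map_compose[OF continuous_map_shift_by[OF XX] cont[unfolded T_def]]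
    by (simp add: T_def o_def)
  have "compactin (full_shift R) Y"
    using image_compactin[OF _ cont\<phi>, of X] compact by (simp add: Y_def top compact_space_def)
  then have "closedin (full_shift R) Y"
    by (rule compactin_imp_closedin[OF Hausdorff_space_full_shift])
  moreover have "shift ` Y = Y"
  proof -
    have "shift ` Y = \<phi> ` shift ` X"
      by (simp add: Y_def image_image shift)
    then show ?thesis
      by (simp add: XX Y_def)
  qed
  ultimately have "subshift R Y"
    using finite by (simp add: subshift_def R_def)
  moreover have "in_variety F R J"
    using in_variety_image[OF wf var] quot by (simp add: R_def)
  moreover have "closed_under F Y (cellwise J)"
    unfolding closed_under_def Y_def tuples_image
  proof (intro ballI)
    fix f ys
    assume f: "f \<in> symbols F" and "ys \<in> map \<phi> ` tuples (arity F f) X"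
    then obtain xs where xs: "xs \<in> tuples (arity F f) X" "ys = map \<phi> xs"
      by blast
    then have "cellwise J f ys = \<phi> (I f xs)"
      using mor[OF f] by simp
    with closed f xs(1) show "cellwise J f ys \<in> \<phi> ` X"
      by (simp add: closed_under_def)
  qed
  moreover have "Y \<subseteq> topspace (full_shift R)"
    using \<open>closedin (full_shift R) Y\<close> by (rule closedin_subset)
  ultimately have "cellwise_subshift F R J Y"
    using finite by (simp add: cellwise_subshift_def subalgebra_of_def R_def)
  moreover have "conjugacy S X R Y \<phi>"
    using cont\<phi> shift inj
    by (auto simp: conjugacy_def block_map_def continuous_map_in_subtopology bij_betw_def Y_def T_def)
  moreover have "morphism F X I Y (cellwise J) \<phi>"
    using mor by (auto simp: morphism_def Y_def)
  ultimately show ?thesis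
    unfolding algebraic_conjugacy_def by blast
qed

theorem corollary3:
  fixes F :: "opsym variety"
    and S :: "'s set"
    and X :: "(int \<Rightarrow> 's) set"
    and I :: "(opsym, int \<Rightarrow> 's) interp"
  assumes "F \<in> {distributive_lattices, boolean_algebras, rings, unital_rings,
                semigroups, monoids, groups}"
    and "variety_subshift F S X I"
  shows "\<exists>(R :: nat set) (J :: (opsym, nat) interp) (Y :: (int \<Rightarrow> nat) set) \<phi>.
           cellwise_subshift F R J Y \<and>
           algebraic_conjugacy F S X I R Y (cellwise J) \<phi>"
proof -
  define T where "T = subtopology (full_shift S) X"
  have S: "finite S" and cl: "closedin (full_shift S) X" and var: "in_variety F X I"
    and ops: "\<And>f. f \<in> symbols F \<Longrightarrow> block_operation S X (arity F f) (I f)"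
    using assms(2) by (auto simp: variety_subshift_def subshift_def)
  have top: "topspace T = X"
    using closedin_subset[OF cl] by (auto simp: T_def)
  have compact: "compact_space T"
    using closedin_compact_space[OF compact_space_full_shift[OF S] cl]
    by (simp add: T_def compact_space_subtopology)
  have "continuous_map T (discrete_topology S) (\<lambda>x. x 0)"
    unfolding T_def full_shift_def
    by (intro continuous_map_from_subtopology continuous_map_product_projection) simp
  from open_equivalence_kernel[OF this]
  have E0: "open_equivalence T {(x, y) \<in> X \<times> X. x 0 = y 0}"
    by (simp add: top)
  have arity: "arity F = op_arity"
    using assms(1) by (auto simp: distributive_lattices_def boolean_algebras_def rings_def
        unital_rings_def semigroups_def monoids_def groups_def)
  have "continuous_map (prod_topology T T) T (\<lambda>(a, x). I f [a, x])"
    if "f \<in> symbols F" "op_arity f = 2" for f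
    unfolding T_def using ops[OF that(1)] that(2) arity
    by (intro continuous_map_binary_block_operation) simp
  then have "\<exists>E\<subseteq>{(x, y) \<in> X \<times> X. x 0 = y 0}. open_equivalence T E \<and> congruence F X I E"
    using open_congruence_exists[where I = I, OF assms(1) _ compact E0] var by (simp add: top)
  then obtain E where E: "E \<subseteq> {(x, y) \<in> X \<times> X. x 0 = y 0}" "open_equivalence T E" "congruence F X I E"
    by blast
  show ?thesis
    using E(1)
    by (intro cellwise_of_open_congruence[OF assms(2) wf_identities_concrete[OF assms(1)]
          E(2)[unfolded T_def] E(3)]) auto
qed

end
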